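(* For every $\varepsilon\in(0,1/4)$ and every $k\ge \varepsilon^{-1}$, any (possibly randomized) two-player protocol for Max-Card-$k$ (in the two-player model described in the context) with an approximation guarantee of $\frac{2}{3}+\varepsilon$ must have communication complexity $\Omega\!\left(\frac{N\varepsilon}{k}\right)$ bits, where $N=|W|$ is the size of the ground set.
   Context: Two-player model for Max-Card-$k$. The global information known to both players consists of a positive integer $k$, a finite ground set $W$, and a partition $W=W_A\,\dot\cup\, W_B$. Alice privately receives a set $V_A\subseteq W_A$ and Bob privately receives a set $V_B\subseteq W_B$. There is a non-negative, monotone, submodular function $f:2^W\to\mathbb{R}_{\ge 0}$; Alice can query $f$ (via a value oracle) only on subsets of $W_A$ (in particular she may query sets of size larger than $k$), while Bob can query $f$ on any subset of $W$. A protocol consists of two possibly randomized algorithms: Alice's algorithm computes a message $m$ (a bit string) from the global information, $V_A$ and her oracle; then Bob's algorithm computes an output set $S\subseteq V_A\cup V_B$ with $|S|\le k$ from the global information, $V_B$, $m$ and his oracle. The communication complexity is the maximum length in bits of $m$ over all inputs and the randomness. The protocol has approximation guarantee $\rho$ if for every instance $\mathbb{E}[f(S)]\ge \rho\cdot\max\{f(T): T\subseteq V_A\cup V_B,\ |T|\le k\}$. *)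

theory Defs
  imports "HOL-Probability.Probability"
begin

definition nonneg_monotone_submodular :: "nat set \<Rightarrow> (nat set \<Rightarrow> real) \<Rightarrow> bool" where
  "nonneg_monotone_submodular W f \<longleftrightarrow>
     (\<forall>A. A \<subseteq> W \<longrightarrow> 0 \<le> f A) \<and>
     (\<forall>A B. A \<subseteq> B \<longrightarrow> B \<subseteq> W \<longrightarrow> f A \<le> f B) \<and>
     (\<forall>A B. A \<subseteq> W \<longrightarrow> B \<subseteq> W \<longrightarrow> f (A \<union> B) + f (A \<inter> B) \<le> f A + f B)"

definition valid_input ::
  "nat set \<Rightarrow> nat set \<Rightarrow> nat set \<Rightarrow> nat set \<Rightarrow> (nat set \<Rightarrow> real) \<Rightarrow> bool" where
  "valid_input WA WB VA VB f \<longleftrightarrow>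
     VA \<subseteq> WA \<and> VB \<subseteq> WB \<and> nonneg_monotone_submodular (WA \<union> WB) f"

definition opt_val :: "nat \<Rightarrow> nat set \<Rightarrow> (nat set \<Rightarrow> real) \<Rightarrow> real" where
  "opt_val k V f = Max (f ` {T. T \<subseteq> V \<and> card T \<le> k})"

text \<open>A protocol for fixed global information (k, W_A, W_B) is given by
  Alice's randomized algorithm: (oracle f, V_A) \<mapsto> distribution of the message (a bit string),
  Bob's randomized algorithm: (oracle f, V_B, message) \<mapsto> distribution of the output set.
  Alice's oracle access is modelled by requiring her behaviour to depend only on f restricted to
  subsets of W_A; Bob's only on f restricted to subsets of W. Randomness is private
  (Bob's coins are independent of Alice's).\<close>

definition protocol_output ::
  "((nat set \<Rightarrow> real) \<Rightarrow> nat set \<Rightarrow> bool list pmf) \<Rightarrow>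
   ((nat set \<Rightarrow> real) \<Rightarrow> nat set \<Rightarrow> bool list \<Rightarrow> nat set pmf) \<Rightarrow>
   (nat set \<Rightarrow> real) \<Rightarrow> nat set \<Rightarrow> nat set \<Rightarrow> nat set pmf" where
  "protocol_output alice bob f VA VB = bind_pmf (alice f VA) (\<lambda>m. bob f VB m)"

definition is_protocol ::
  "nat \<Rightarrow> nat set \<Rightarrow> nat set \<Rightarrow>
   ((nat set \<Rightarrow> real) \<Rightarrow> nat set \<Rightarrow> bool list pmf) \<Rightarrow>
   ((nat set \<Rightarrow> real) \<Rightarrow> nat set \<Rightarrow> bool list \<Rightarrow> nat set pmf) \<Rightarrow> bool" where
  "is_protocol k WA WB alice bob \<longleftrightarrow>
     (\<forall>f g VA. (\<forall>T. T \<subseteq> WA \<longrightarrow> f T = g T) \<longrightarrow> alice f VA = alice g VA) \<and>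
     (\<forall>f g VB m. (\<forall>T. T \<subseteq> WA \<union> WB \<longrightarrow> f T = g T) \<longrightarrow> bob f VB m = bob g VB m) \<and>
     (\<forall>VA VB f. valid_input WA WB VA VB f \<longrightarrow>
        (\<forall>m \<in> set_pmf (alice f VA). \<forall>S \<in> set_pmf (bob f VB m).
            S \<subseteq> VA \<union> VB \<and> card S \<le> k))"

definition approx_guarantee ::
  "nat \<Rightarrow> nat set \<Rightarrow> nat set \<Rightarrow>
   ((nat set \<Rightarrow> real) \<Rightarrow> nat set \<Rightarrow> bool list pmf) \<Rightarrow>
   ((nat set \<Rightarrow> real) \<Rightarrow> nat set \<Rightarrow> bool list \<Rightarrow> nat set pmf) \<Rightarrow> real \<Rightarrow> bool" where
  "approx_guarantee k WA WB alice bob \<rho> \<longleftrightarrow>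
     (\<forall>VA VB f. valid_input WA WB VA VB f \<longrightarrow>
        measure_pmf.expectation (protocol_output alice bob f VA VB) f
          \<ge> \<rho> * opt_val k (VA \<union> VB) f)"

definition comm_complexity_ge ::
  "nat set \<Rightarrow> nat set \<Rightarrow> ((nat set \<Rightarrow> real) \<Rightarrow> nat set \<Rightarrow> bool list pmf) \<Rightarrow> real \<Rightarrow> bool" where
  "comm_complexity_ge WA WB alice x \<longleftrightarrow>
     (\<exists>VA VB f. valid_input WA WB VA VB f \<and>
        (\<exists>m \<in> set_pmf (alice f VA). real (length m) \<ge> x))"

end

theory Submission
  imports Defs
begin

text \<open>
  Alice's ground set is cut into about $N/k$ blocks of size $q = k - 1$, and she holds a union of
  blocks, indexed by a set $X$. Bob holds one further element $w$ and a block index $t$, which enters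
  only through the values of $f$ on sets containing $w$ and is therefore invisible to Alice. If
  $t \in X$ the optimum is $9 q^2$, whereas a feasible set avoiding block $t$ is worth at most
  $6 q^2$. Hence Bob's output meets block $t$ with probability at least $3 \varepsilon$ if $t \in X$,
  and never if $t \notin X$, since outputs consist of available elements. So each message $m$
  determines the set $Z(m)$ of indices whose block Bob may hit; $Z(m) \subseteq X$ always, and
  averaging yields a message with $|Z(m)| \ge 3 \varepsilon |X|$. A message with $|Z(m)| = z$ is
  compatible with a fraction $2^{-z}$ of all $X$, so $2^{\Omega(\varepsilon N / k)}$ messages are needed.
  When the claimed bound is below one bit, it suffices that the empty message alone cannot tell Bob
  whether an element is available.
\<close>

section \<open>Submodularity from diminishing returns of single elements\<close>

lemma nonneg_monotone_submodularI:
  fixes f :: "nat set \<Rightarrow> real"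
  assumes fin: "finite W"
    and empty: "0 \<le> f {}"
    and mono: "\<And>A x. A \<subseteq> W \<Longrightarrow> x \<in> W - A \<Longrightarrow> f A \<le> f (insert x A)"
    and dimret: "\<And>A B x. A \<subseteq> B \<Longrightarrow> B \<subseteq> W \<Longrightarrow> x \<in> W - B \<Longrightarrow>
      f (insert x B) - f B \<le> f (insert x A) - f A"
  shows "nonneg_monotone_submodular W f"
proof -
  have mono': "f A \<le> f (A \<union> C)" if "A \<union> C \<subseteq> W" for A C
  proof -
    have "finite C" using that fin by (meson finite_subset le_sup_iff)
    then show ?thesis using that
    proof (induction C rule: finite_induct)
      case (insert x C)
      then have "f A \<le> f (A \<union> C)" by auto
      also have "\<dots> \<le> f (insert x (A \<union> C))"
        using mono[of "A \<union> C" x] insert.prems by (cases "x \<in> A \<union> C") (auto simp: insert_absorb)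
      finally show ?case by simp
    qed simp
  qed
  have sub: "f (B \<union> C) - f B \<le> f (A \<union> C) - f A"
    if "A \<subseteq> B" "B \<union> C \<subseteq> W" "B \<inter> C = {}" for A B C
  proof -
    have "finite C" using that fin by (meson finite_subset le_sup_iff)
    then show ?thesis using that
    proof (induction C rule: finite_induct)
      case (insert x C)
      then have "f (B \<union> C) - f B \<le> f (A \<union> C) - f A" by auto
      moreover have "f (insert x (B \<union> C)) - f (B \<union> C) \<le> f (insert x (A \<union> C)) - f (A \<union> C)"
        using insert by (intro dimret) auto
      ultimately show ?case by simp
    qed simp
  qed
  show ?thesis
    unfolding nonneg_monotone_submodular_def
  proof (intro conjI allI impI)
    show "0 \<le> f A" if "A \<subseteq> W" for A
      using mono'[of "{}" A] empty that by simp
    show "f A \<le> f B" if "A \<subseteq> B" "B \<subseteq> W" for A B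
      using mono'[of A B] that by (simp add: Un_absorb1)
    show "f (A \<union> B) + f (A \<inter> B) \<le> f A + f B" if "A \<subseteq> W" "B \<subseteq> W" for A B
    proof -
      have "B \<union> (A - B) = A \<union> B" "(A \<inter> B) \<union> (A - B) = A" by auto
      then show ?thesis using sub[of "A \<inter> B" B "A - B"] that by auto
    qed
  qed
qed

section \<open>The hard functions: submodularity and extremal values\<close>

definition pos_sq :: "int \<Rightarrow> int" where
  "pos_sq x = (max 0 x)\<^sup>2"

lemma pos_sq_decr: "pos_sq (x - 1) = pos_sq x - max 0 (2 * x - 1)"
  by (cases "x \<ge> 1") (auto simp: pos_sq_def max_def power2_eq_square algebra_simps)

lemma pos_sq_mono: "x \<le> y \<Longrightarrow> pos_sq x \<le> pos_sq y"
  by (simp add: pos_sq_def max_def power_mono)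

text \<open>
  Rescaling $q$ and the values to $1$, the function without $w$ is $g(s) = 1 - (1 - s/3)_+^2$ in the
  number $s$ of Alice's elements, and the marginal value of $w$ is $(2 - o)_+^2 / 9$ in the number $o$
  of elements outside the block $P$. The coefficients come from a quadratic ansatz for $g$, in which
  monotonicity and submodularity leave just this solution with ratio $2/3$.
\<close>

definition hard_val :: "nat \<Rightarrow> nat set \<Rightarrow> nat \<Rightarrow> nat set \<Rightarrow> nat set \<Rightarrow> int" where
  "hard_val q A w P S = 9 * (int q)\<^sup>2 - pos_sq (3 * int q - int (card (S \<inter> A)))
     + (if w \<in> S then pos_sq (2 * int q - int (card (S \<inter> (A - P)))) else 0)"

lemma card_insert_int: 
  assumes "finite A" "x \<notin> S"
  shows "int (card (insert x S \<inter> A)) = int (card (S \<inter> A)) + (if x \<in> A then 1 else 0)"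
  using assms by (simp add: Int_insert_left)

text \<open>By \<open>pos_sq_decr\<close>, adding an element of \<open>A\<close> changes each square
  by a truncated linear term, which reduces most of the submodularity proof to linear arithmetic in
  cardinalities.\<close>

lemma hard_val_marginal:
  assumes "finite A" "w \<notin> A" "P \<subseteq> A" "x \<notin> S" "x \<in> insert w A"
  shows "hard_val q A w P (insert x S) - hard_val q A w P S =
    (if x = w then pos_sq (2 * int q - int (card (S \<inter> (A - P))))
     else max 0 (2 * (3 * int q - int (card (S \<inter> A))) - 1)
       - (if x \<notin> P \<and> w \<in> S then max 0 (2 * (2 * int q - int (card (S \<inter> (A - P)))) - 1) else 0))"
proof -
  \<comment> \<open>This orientation exposes the \<open>- 1\<close> that \<open>pos_sq_decr\<close>
    matches; the two deleted simp rules would merge it back.\<close>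
  have [simp]: "a - (b + 1) = (a - b) - 1" for a b :: int by simp
  show ?thesis
    using assms unfolding hard_val_def
    by (auto simp: card_insert_int pos_sq_decr simp del: diff_diff_eq diff_diff_add)
qed

text \<open>Since \<open>S\<close> has at most \<open>q\<close> elements in \<open>P\<close>, the
  argument of the subtracted square is at least that of the bonus of \<open>w\<close>. Hence what an
  element outside \<open>P\<close> gains in the first covers what it loses in the second. This
  surplus shrinks as \<open>S\<close> grows because \<open>max 0 (2 * x - 1)\<close> is
  nondecreasing and convex in \<open>x\<close>.\<close>

lemma hard_val_submodular:
  assumes "finite A" "w \<notin> A" "P \<subseteq> A" "card P = q"
  shows "nonneg_monotone_submodular (insert w A) (\<lambda>S. real_of_int (hard_val q A w P S))"
proof (rule nonneg_monotone_submodularI)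
  have card_split: "card (S \<inter> A) = card (S \<inter> P) + card (S \<inter> (A - P))"
    "card (S \<inter> P) \<le> q" for S
  proof -
    have "S \<inter> A = (S \<inter> P) \<union> (S \<inter> (A - P))" using assms(3) by auto
    then show "card (S \<inter> A) = card (S \<inter> P) + card (S \<inter> (A - P))"
      using card_Un_disjoint[of "S \<inter> P" "S \<inter> (A - P)"] assms(1,3)
      by (metis Diff_disjoint Int_assoc Int_empty_right finite_Diff finite_Int finite_subset inf_left_commute)
    show "card (S \<inter> P) \<le> q"
      using assms by (metis card_mono finite_subset inf_le2)
  qed
  show "finite (insert w A)" using assms by simp
  show "0 \<le> real_of_int (hard_val q A w P {})"
    by (simp add: hard_val_def pos_sq_def power2_eq_square)
  show "real_of_int (hard_val q A w P S) \<le> real_of_int (hard_val q A w P (insert x S))"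
    if "S \<subseteq> insert w A" "x \<in> insert w A - S" for S x
  proof -
    have "0 \<le> pos_sq (2 * int q - int (card (S \<inter> (A - P))))" by (simp add: pos_sq_def)
    then have "0 \<le> hard_val q A w P (insert x S) - hard_val q A w P S"
      using that assms card_split[of S] by (subst hard_val_marginal) (auto simp: max_def)
    then show ?thesis by linarith
  qed
  show "real_of_int (hard_val q A w P (insert x T)) - real_of_int (hard_val q A w P T)
      \<le> real_of_int (hard_val q A w P (insert x S)) - real_of_int (hard_val q A w P S)"
    if "S \<subseteq> T" "T \<subseteq> insert w A" "x \<in> insert w A - T" for S T x
  proof -
    have le: "card (S \<inter> B) \<le> card (T \<inter> B)" if "B \<subseteq> A" for B
      using \<open>S \<subseteq> T\<close> that assms(1) by (meson Int_mono card_mono finite_Int finite_subset order_refl)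
    have "pos_sq (2 * int q - int (card (T \<inter> (A - P)))) \<le> pos_sq (2 * int q - int (card (S \<inter> (A - P))))"
      using le[of "A - P"] by (intro pos_sq_mono) auto
    then have "hard_val q A w P (insert x T) - hard_val q A w P T
      \<le> hard_val q A w P (insert x S) - hard_val q A w P S"
      using that assms card_split[of S] card_split[of T] le[of "A - P"] le[of P]
      by (subst (1 2) hard_val_marginal) (auto simp: max_def)
    then show ?thesis by linarith
  qed
qed

text \<open>The same comparison of arguments shows that the bonus of \<open>w\<close> never exceeds
  the subtracted square, whatever the size of \<open>S\<close>.\<close>

lemma hard_val_le:
  assumes "finite A" "P \<subseteq> A" "card P = q"
  shows "hard_val q A w P S \<le> 9 * (int q)\<^sup>2"
proof -
  have "card (S \<inter> A) \<le> card (S \<inter> (A - P)) + card P"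
    using assms by (intro order.trans[OF card_mono card_Un_le]) (auto intro: finite_subset)
  then have "pos_sq (2 * int q - int (card (S \<inter> (A - P)))) \<le> pos_sq (3 * int q - int (card (S \<inter> A)))"
    using assms by (intro pos_sq_mono) auto
  then show ?thesis by (auto simp: hard_val_def pos_sq_def)
qed

text \<open>In the application \<open>q = k - 1\<close>, so that this set just fits the cardinality
  bound.\<close>

lemma hard_val_opt:
  assumes "w \<notin> A" "P \<subseteq> A" "card P = q"
  shows "hard_val q A w P (insert w P) = 9 * (int q)\<^sup>2"
proof -
  have "insert w P \<inter> A = P" "insert w P \<inter> (A - P) = {}" using assms by auto
  then show ?thesis using assms by (simp add: hard_val_def pos_sq_def)
qed

text \<open>With \<open>w\<close>, only \<open>s \<le> q\<close> elements of \<open>A\<close> fit;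
  all lie outside \<open>P\<close>, and the value is \<open>4 q^2 + 2 q s\<close>. Without
  \<open>w\<close> there is room for \<open>q + 1\<close> of them, and \<open>4 \<le> q\<close>
  absorbs the resulting linear term.\<close>

lemma hard_val_miss:
  assumes "finite A" "w \<notin> A" "finite S" "card S \<le> q + 1" "S \<inter> P = {}" "4 \<le> q"
  shows "hard_val q A w P S \<le> 6 * (int q)\<^sup>2"
proof (cases "w \<in> S")
  case True
  have eq: "S \<inter> (A - P) = S \<inter> A" using assms by auto
  define s where "s = int (card (S \<inter> A))"
  have "card (S \<inter> A) < card S"
    using True assms by (intro psubset_card_mono) auto
  then have "s \<le> int q" using assms(4) by (simp add: s_def)
  then have "hard_val q A w P S = 9 * (int q)\<^sup>2 - (3 * int q - s)\<^sup>2 + (2 * int q - s)\<^sup>2"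
    using True by (simp add: hard_val_def pos_sq_def eq s_def)
  also have "\<dots> = 4 * (int q)\<^sup>2 + 2 * (int q * s)"
    by (simp add: power2_eq_square algebra_simps)
  also have "int q * s \<le> int q * int q" using \<open>s \<le> int q\<close> by (intro mult_left_mono) auto
  finally show ?thesis by (simp add: power2_eq_square)
next
  case False
  have "card (S \<inter> A) \<le> card S" using assms by (intro card_mono) auto
  then have "pos_sq (2 * int q - 1) \<le> pos_sq (3 * int q - int (card (S \<inter> A)))"
    using assms(4) by (intro pos_sq_mono) auto
  then have "hard_val q A w P S \<le> 9 * (int q)\<^sup>2 - (2 * int q - 1)\<^sup>2"
    using False assms(6) by (simp add: hard_val_def pos_sq_def)
  also have "\<dots> = 5 * (int q)\<^sup>2 + 4 * int q - 1" by (simp add: power2_eq_square algebra_simps)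
  also have "4 * int q \<le> int q * int q" using assms(6) by (intro mult_right_mono) auto
  finally show ?thesis by (simp add: power2_eq_square)
qed

section \<open>Counting messages that approximate sets from inside\<close>

lemma card_half_subsets:
  "2 ^ n \<le> 2 * card {X. X \<subseteq> {..<n::nat} \<and> n \<le> 2 * card X}" (is "_ \<le> 2 * card ?L")
proof -
  let ?S = "{X. X \<subseteq> {..<n} \<and> 2 * card X < n}"
  have fin: "finite ?L" "finite ?S" by (auto intro: finite_subset[of _ "Pow {..<n}"])
  have "card ?S \<le> card ?L"
  proof (rule card_inj_on_le)
    show "inj_on (\<lambda>X. {..<n} - X) ?S" by (auto intro!: inj_onI)
    show "(\<lambda>X. {..<n} - X) ` ?S \<subseteq> ?L"
      by (auto simp: card_Diff_subset finite_subset)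
  qed (rule fin)
  moreover have "Pow {..<n} = ?L \<union> ?S" by auto
  then have "2 ^ n = card (?L \<union> ?S)" by (metis card_Pow card_lessThan finite_lessThan)
  then have "2 ^ n \<le> card ?L + card ?S" using card_Un_le[of ?L ?S] by (rule ord_eq_le_trans)
  ultimately show ?thesis by simp
qed

lemma card_supersets:
  assumes "finite U" "Z \<subseteq> U"
  shows "card {X. Z \<subseteq> X \<and> X \<subseteq> U} = 2 ^ (card U - card Z)"
proof -
  have "bij_betw (\<lambda>Y. Z \<union> Y) (Pow (U - Z)) {X. Z \<subseteq> X \<and> X \<subseteq> U}"
    using assms by (intro bij_betw_byWitness[where f' = "\<lambda>X. X - Z"]) auto
  then have "card (Pow (U - Z)) = card {X. Z \<subseteq> X \<and> X \<subseteq> U}" by (rule bij_betw_same_card)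
  then show ?thesis
    using assms by (simp add: card_Pow card_Diff_subset finite_subset)
qed

text \<open>Union bound: each suitable \<open>m\<close> serves at most
  \<open>2 powr (n - r * n / 2)\<close> sets \<open>X\<close>, while at least
  \<open>2 ^ (n - 1)\<close> large ones have to be served. The factor \<open>2\<close> on the right
  pays for discarding the small sets.\<close>

lemma inner_approximation_count:
  fixes Z :: "'m \<Rightarrow> nat set" and r :: real
  assumes fin: "finite M" and r: "0 \<le> r"
    and approx: "\<And>X. X \<subseteq> {..<n} \<Longrightarrow> \<exists>m\<in>M. Z m \<subseteq> X \<and> r * real (card X) \<le> real (card (Z m))"
  shows "2 powr (r * n / 2) \<le> 2 * real (card M)"
proof -
  let ?L = "{X. X \<subseteq> {..<n} \<and> n \<le> 2 * card X}"
  \<comment> \<open>For large \<open>X\<close> the approximation condition implies the uniform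
    threshold \<open>r * n / 2\<close>; a smaller \<open>Z m\<close> could serve too many
    sets.\<close>
  let ?G = "{m \<in> M. Z m \<subseteq> {..<n} \<and> r * n / 2 \<le> real (card (Z m))}"
  let ?U = "\<lambda>m. {X. Z m \<subseteq> X \<and> X \<subseteq> {..<n}}"
  have finG: "finite ?G" using fin by auto
  have "?L \<subseteq> (\<Union>m\<in>?G. ?U m)"
  proof
    fix X assume X: "X \<in> ?L"
    then obtain m where m: "m \<in> M" "Z m \<subseteq> X" "r * real (card X) \<le> real (card (Z m))"
      using approx by blast
    have "r * (n / 2) \<le> r * real (card X)" using X r by (intro mult_left_mono) auto
    then have "m \<in> ?G" using m X by auto
    then show "X \<in> (\<Union>m\<in>?G. ?U m)" using m X by blast
  qed
  then have "card ?L \<le> card (\<Union>m\<in>?G. ?U m)"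
    using finG by (intro card_mono) (auto intro: finite_subset[of _ "Pow {..<n}"])
  also have "\<dots> \<le> (\<Sum>m\<in>?G. card (?U m))" by (rule card_UN_le[OF finG])
  finally have "real (card ?L) \<le> real (\<Sum>m\<in>?G. card (?U m))" by (rule of_nat_mono)
  also have "\<dots> = (\<Sum>m\<in>?G. real (card (?U m)))" by (rule of_nat_sum)
  also have "\<dots> \<le> (\<Sum>m\<in>?G. 2 powr (n - r * n / 2))"
  proof (rule sum_mono)
    fix m assume m: "m \<in> ?G"
    then have "card (Z m) \<le> n" by (metis (no_types, lifting) card_lessThan card_mono finite_lessThan mem_Collect_eq)
    moreover have "card (?U m) = 2 ^ (n - card (Z m))" using m card_supersets[of "{..<n}" "Z m"] by simp
    ultimately have "real (card (?U m)) = 2 powr (real n - card (Z m))"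
      by (simp flip: powr_realpow add: of_nat_diff)
    also have "\<dots> \<le> 2 powr (n - r * n / 2)" using m by simp
    finally show "real (card (?U m)) \<le> 2 powr (n - r * n / 2)" .
  qed
  also have "\<dots> \<le> card M * 2 powr (n - r * n / 2)"
    using fin by (simp add: card_mono)
  finally have "2 powr n \<le> 2 * real (card M) * 2 powr (n - r * n / 2)"
    using of_nat_mono[OF card_half_subsets[of n], where 'a = real] by (simp add: powr_realpow)
  moreover have "2 powr n = 2 powr (r * n / 2) * 2 powr (n - r * n / 2)"
    by (subst powr_add[symmetric]) simp
  ultimately have "2 powr (r * n / 2) * 2 powr (n - r * n / 2)
      \<le> 2 * real (card M) * 2 powr (n - r * n / 2)"
    by simp
  then show ?thesis by (rule mult_right_le_imp_le) simp
qed

section \<open>From expectations to possible outcomes\<close>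

text \<open>Given \<open>m\<close>, the event has probability at most 1, and 0 if the support of
  \<open>B m\<close> misses \<open>H\<close>. The new event depends on \<open>m\<close> alone, which
  removes Bob's coins.\<close>

lemma measure_bind_pmf_le_support:
  "measure_pmf.prob (bind_pmf p B) H \<le> measure_pmf.prob p {m. set_pmf (B m) \<inter> H \<noteq> {}}"
proof -
  have "emeasure (bind_pmf p B) H = (\<integral>\<^sup>+m. emeasure (B m) H \<partial>measure_pmf p)" by simp
  also have "\<dots> \<le> (\<integral>\<^sup>+m. indicator {m. set_pmf (B m) \<inter> H \<noteq> {}} m \<partial>measure_pmf p)"
  proof (rule nn_integral_mono)
    fix m
    show "emeasure (B m) H \<le> indicator {m. set_pmf (B m) \<inter> H \<noteq> {}} m"
      using measure_pmf.emeasure_le_1[of "B m" H]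
      by (auto simp: indicator_def measure_pmf.emeasure_eq_measure measure_pmf_zero_iff)
  qed
  also have "\<dots> = emeasure p {m. set_pmf (B m) \<inter> H \<noteq> {}}" by (subst nn_integral_indicator) auto
  finally show ?thesis by (simp add: measure_pmf.emeasure_eq_measure)
qed

text \<open>By linearity of expectation the mean of the count is at least \<open>r * card X\<close>,
  so some outcome in the support reaches it. Intersecting with \<open>X\<close> keeps the count
  bounded for arbitrary \<open>Z m\<close>.\<close>

lemma exists_outcome_many:
  fixes p :: "'m pmf" and Z :: "'m \<Rightarrow> 'b set" and r :: real
  assumes "finite X" and r: "\<And>t. t \<in> X \<Longrightarrow> r \<le> measure_pmf.prob p {m. t \<in> Z m}"
  shows "\<exists>m\<in>set_pmf p. r * real (card X) \<le> real (card (Z m \<inter> X))"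
proof (rule ccontr)
  assume "\<not> ?thesis"
  then have less: "real (card (Z m \<inter> X)) < r * real (card X)" if "m \<in> set_pmf p" for m
    using that by force
  have int: "integrable (measure_pmf p) (\<lambda>m. real (card (Z m \<inter> X)))"
    using assms(1) by (intro measure_pmf.integrable_const_bound[where B = "card X"]) (auto simp: card_mono)
  have card_eq: "real (card (Z m \<inter> X)) = (\<Sum>t\<in>X. indicator {m. t \<in> Z m} m)" for m
    using assms(1) by (simp add: indicator_def sum.If_cases Int_commute Int_def)
  have "r * real (card X) = (\<Sum>t\<in>X. r)" by simp
  also have "\<dots> \<le> (\<Sum>t\<in>X. measure_pmf.prob p {m. t \<in> Z m})" by (intro sum_mono r)
  also have "\<dots> = measure_pmf.expectation p (\<lambda>m. real (card (Z m \<inter> X)))"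
    unfolding card_eq by (subst Bochner_Integration.integral_sum)
      (auto intro!: measure_pmf.integrable_const_bound[where B = 1])
  also have "\<dots> < r * real (card X)"
    using less by (intro measure_pmf.expectation_less int) (simp add: AE_measure_pmf_iff)
  finally show False by simp
qed

text \<open>Pointwise the value is at most \<open>6 q^2\<close>, plus \<open>3 q^2\<close> if the
  output meets \<open>P\<close>. The guarantee exceeds \<open>6 q^2\<close> by
  \<open>9 \<epsilon> q^2\<close>, which only the second term can supply.\<close>

lemma hard_val_hit_prob:
  fixes D :: "nat set pmf" and \<epsilon> :: real
  assumes A: "finite A" "w \<notin> A" "P \<subseteq> A" "card P = q" "4 \<le> q"
    and D: "\<And>S. S \<in> set_pmf D \<Longrightarrow> finite S \<and> card S \<le> q + 1"
    and E: "(2/3 + \<epsilon>) * (9 * (real q)\<^sup>2)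
      \<le> measure_pmf.expectation D (\<lambda>S. real_of_int (hard_val q A w P S))"
  shows "3 * \<epsilon> \<le> measure_pmf.prob D {S. S \<inter> P \<noteq> {}}"
proof -
  let ?H = "{S. S \<inter> P \<noteq> {}}" and ?f = "\<lambda>S. real_of_int (hard_val q A w P S)"
  have le9: "?f S \<le> 9 * (real q)\<^sup>2" for S
  proof -
    have "?f S \<le> real_of_int (9 * (int q)\<^sup>2)"
      using hard_val_le[OF A(1,3,4), of w S] by (rule of_int_le_iff[THEN iffD2])
    then show ?thesis by simp
  qed
  have bound: "?f S \<le> 6 * (real q)\<^sup>2 + 3 * (real q)\<^sup>2 * indicator ?H S" if "S \<in> set_pmf D" for S
  proof (cases "S \<in> ?H")
    case True
    then show ?thesis using le9[of S] by simp
  next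
    case False
    then have "hard_val q A w P S \<le> 6 * (int q)\<^sup>2"
      using D[OF that] A by (intro hard_val_miss) auto
    then have "?f S \<le> real_of_int (6 * (int q)\<^sup>2)" by (rule of_int_le_iff[THEN iffD2])
    then show ?thesis using False by simp
  qed
  have int: "integrable (measure_pmf D) ?f"
  proof (rule measure_pmf.integrable_const_bound[where B = "9 * (real q)\<^sup>2"])
    have "0 \<le> hard_val q A w P S" for S
    proof -
      have "pos_sq (3 * int q - int (card (S \<inter> A))) \<le> pos_sq (3 * int q)"
        by (intro pos_sq_mono) simp
      moreover have "pos_sq (3 * int q) = 9 * (int q)\<^sup>2" by (simp add: pos_sq_def power2_eq_square)
      moreover have "0 \<le> pos_sq x" for x by (simp add: pos_sq_def)
      ultimately show ?thesis by (simp add: hard_val_def add_nonneg_nonneg)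
    qed
    then show "AE S in measure_pmf D. norm (?f S) \<le> 9 * (real q)\<^sup>2" using le9 by simp
  qed simp
  have ind: "integrable (measure_pmf D) (indicat_real ?H)"
    by (rule measure_pmf.integrable_const_bound[where B = 1]) auto
  have "(2/3 + \<epsilon>) * (9 * (real q)\<^sup>2) \<le> measure_pmf.expectation D ?f" by (rule E)
  also have "\<dots> \<le> measure_pmf.expectation D (\<lambda>S. 6 * (real q)\<^sup>2 + 3 * (real q)\<^sup>2 * indicator ?H S)"
    using bound ind by (intro integral_mono_AE int) (auto simp: AE_measure_pmf_iff)
  also have "\<dots> = 6 * (real q)\<^sup>2 + 3 * (real q)\<^sup>2 * measure_pmf.prob D ?H"
    using ind by simp
  finally have "(3 * (real q)\<^sup>2) * (3 * \<epsilon>) \<le> (3 * (real q)\<^sup>2) * measure_pmf.prob D ?H"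
    by (simp add: algebra_simps)
  then show ?thesis using A(5) by (subst (asm) mult_le_cancel_left_pos) auto
qed

section \<open>Protocols that send nothing\<close>

text \<open>With only the empty message, Bob cannot tell \<open>VA = {}\<close> from
  \<open>VA = {0}\<close>. Feasibility for the former forces the output \<open>{}\<close>, which is
  worthless for the latter.\<close>

lemma one_bit_necessary:
  assumes "0 < N" and prot: "is_protocol k {..<N} {} alice bob"
    and approx: "approx_guarantee k {..<N} {} alice bob \<rho>" and "0 < \<rho>" "1 \<le> k"
  shows "comm_complexity_ge {..<N} {} alice 1"
proof (rule ccontr)
  assume contra: "\<not> ?thesis"
  define f :: "nat set \<Rightarrow> real" where "f S = real (card (S \<inter> {..<N}))" for S
  have sub: "nonneg_monotone_submodular {..<N} f"
    by (rule nonneg_monotone_submodularI) (auto simp: f_def card_insert_if)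
  then have valid: "valid_input {..<N} {} VA {} f" if "VA \<subseteq> {..<N}" for VA
    using that by (simp add: valid_input_def)
  have msg: "set_pmf (alice f VA) = {[]}" if "VA \<subseteq> {..<N}" for VA
  proof -
    have "m = []" if "m \<in> set_pmf (alice f VA)" for m
      using contra valid[OF \<open>VA \<subseteq> {..<N}\<close>] that unfolding comm_complexity_ge_def
      by (metis One_nat_def Suc_leI length_greater_0_conv of_nat_1 of_nat_le_iff)
    then show ?thesis using set_pmf_not_empty[of "alice f VA"] by blast
  qed
  have empty: "S = {}" if "S \<in> set_pmf (bob f {} [])" for S
    using prot valid[of "{}"] msg[of "{}"] that unfolding is_protocol_def
    by (metis Un_empty_right empty_subsetI insertI1 subset_empty)
  have "alice f {0} = return_pmf []"
    using msg[of "{0}"] \<open>0 < N\<close> set_pmf_subset_singleton[of "alice f {0}" "[]"] by simp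
  then have "protocol_output alice bob f {0} {} = bob f {} []"
    by (simp add: protocol_output_def bind_return_pmf)
  moreover have "measure_pmf.expectation (bob f {} []) f = measure_pmf.expectation (bob f {} []) (\<lambda>_. 0)"
    using empty by (intro integral_cong_AE) (auto simp: AE_measure_pmf_iff f_def)
  ultimately have "\<rho> * opt_val k {0} f \<le> 0"
    using approx valid[of "{0}"] \<open>0 < N\<close> unfolding approx_guarantee_def by fastforce
  moreover have "1 \<le> opt_val k {0} f"
  proof -
    have "f {0} \<le> opt_val k {0} f"
      unfolding opt_val_def using \<open>1 \<le> k\<close> by (intro Max_ge) auto
    then show ?thesis using \<open>0 < N\<close> by (simp add: f_def)
  qed
  ultimately show False using \<open>0 < \<rho>\<close> by (simp add: mult_le_0_iff)
qed

section \<open>Blocks, short bit strings and the hard family of instances\<close>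

text \<open>The blocks start at 1 because \<open>0\<close> serves as Bob's element.\<close>

definition block :: "nat \<Rightarrow> nat \<Rightarrow> nat set" where
  "block q i = {1 + i * q..<1 + (i + 1) * q}"

lemma card_block [simp]: "card (block q i) = q"
  by (simp add: block_def)

lemma block_subset:
  assumes "i < (N - 1) div q"
  shows "block q i \<subseteq> {1..<N}"
proof -
  have "(i + 1) * q \<le> (N - 1) div q * q" using assms by (intro mult_right_mono) auto
  also have "\<dots> \<le> N - 1" by (rule div_times_less_eq_dividend)
  finally show ?thesis by (auto simp: block_def)
qed

text \<open>This is the form in which disjointness of the blocks is used.\<close>

lemma mem_block_eq: "x \<in> block q i \<Longrightarrow> i = (x - 1) div q"
  by (rule sym, rule div_nat_eqI) (auto simp: block_def algebra_simps)

lemma card_bool_lists_less: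
  fixes x :: real
  assumes "0 \<le> x"
  shows "finite {m :: bool list. real (length m) < x}"
    and "real (card {m :: bool list. real (length m) < x}) \<le> 2 powr (x + 1)"
proof -
  define L where "L = nat \<lfloor>x\<rfloor>"
  have sub: "{m :: bool list. real (length m) < x} \<subseteq> {m. set m \<subseteq> UNIV \<and> length m \<le> L}" (is "?M \<subseteq> ?B")
    by (auto simp: L_def le_nat_floor)
  have fin: "finite ?B" using finite_lists_length_le[of "UNIV :: bool set" L] by simp
  then show "finite ?M" using sub by (rule finite_subset[rotated])
  have "card ?M \<le> card ?B" by (rule card_mono[OF fin sub])
  also have "\<dots> = (\<Sum>i\<le>L. 2 ^ i)" by (subst card_lists_length_le) auto
  also have "\<dots> \<le> 2 ^ (L + 1)"
    using sum_power2[of "Suc L"] by (simp add: lessThan_Suc_atMost atLeast0LessThan)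
  finally have "real (card ?M) \<le> real (2 ^ (L + 1))" by (rule of_nat_mono)
  also have "\<dots> = 2 powr (real L + 1)" by (simp add: powr_realpow powr_add)
  also have "\<dots> \<le> 2 powr (x + 1)" using assms by (simp add: L_def)
  finally show "real (card ?M) \<le> 2 powr (x + 1)" .
qed

text \<open>The summand \<open>2\<close> collects two factors of 2: one from keeping only the large
  \<open>X\<close>, one from bounding the number of strings shorter than \<open>x\<close> by
  \<open>2 powr (x + 1)\<close>.\<close>

lemma hard_instance_messages:
  fixes k N :: nat and \<epsilon> x :: real
  defines "q \<equiv> k - 1" and "n \<equiv> (N - 1) div (k - 1)"
  assumes k: "5 \<le> k" and \<epsilon>: "0 < \<epsilon>" and x: "0 \<le> x"
    and prot: "is_protocol k {1..<N} {0} alice bob"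
    and approx: "approx_guarantee k {1..<N} {0} alice bob (2/3 + \<epsilon>)"
    and short: "\<not> comm_complexity_ge {1..<N} {0} alice x"
  shows "3 * \<epsilon> * n / 2 \<le> x + 2"
proof -
  define f where "f t S = real_of_int (hard_val q {1..<N} 0 (block q t) S)" for t S
  define VA where "VA X = (\<Union>i\<in>X. block q i)" for X
  define Z where "Z m = {t. t < n \<and> set_pmf (bob (f t) {0} m) \<inter> {S. S \<inter> block q t \<noteq> {}} \<noteq> {}}" for m
  have blk: "block q t \<subseteq> {1..<N}" if "t < n" for t
    using that block_subset[of t N q] by (simp add: n_def q_def)
  have VA_sub: "VA X \<subseteq> {1..<N}" if "X \<subseteq> {..<n}" for X
    using that blk by (auto simp: VA_def)
  have valid: "valid_input {1..<N} {0} (VA X) {0} (f t)" if "X \<subseteq> {..<n}" "t < n" for X t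
    using VA_sub[OF that(1)] hard_val_submodular[of "{1..<N}" 0 "block q t" q] blk[OF that(2)]
    by (simp add: valid_input_def f_def[abs_def] Un_commute)
  have alice_eq: "alice (f t) V = alice (f 0) V" for t V
  proof -
    have "\<forall>T\<subseteq>{1..<N}. f t T = f 0 T" by (auto simp: f_def hard_val_def)
    then show ?thesis using prot unfolding is_protocol_def by blast
  qed
  \<comment> \<open>The message is drawn under \<open>f 0\<close> while Bob runs with
    \<open>f t\<close>. By \<open>alice_eq\<close> this is a genuine run, so one message can be
    tested against all indices \<open>t\<close> at once.\<close>
  have out: "S \<subseteq> VA X \<union> {0} \<and> card S \<le> k"
    if "X \<subseteq> {..<n}" "t < n" "m \<in> set_pmf (alice (f 0) (VA X))" "S \<in> set_pmf (bob (f t) {0} m)" for X t m S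
    using prot valid[OF that(1,2)] that(3,4) alice_eq[of t "VA X"] unfolding is_protocol_def by metis
  have Z_sub: "Z m \<subseteq> X" if X: "X \<subseteq> {..<n}" and m: "m \<in> set_pmf (alice (f 0) (VA X))" for X m
  proof
    fix t assume "t \<in> Z m"
    then obtain S y where t: "t < n" and S: "S \<in> set_pmf (bob (f t) {0} m)" and y: "y \<in> S" "y \<in> block q t"
      by (auto simp: Z_def)
    have "y \<noteq> 0" using y(2) by (simp add: block_def)
    then have "y \<in> VA X" using out[OF X t m S] y(1) by auto
    then obtain i where "i \<in> X" "y \<in> block q i" by (auto simp: VA_def)
    then show "t \<in> X" using mem_block_eq[OF y(2)] mem_block_eq[of y q i] by simp
  qed
  have Z_prob: "3 * \<epsilon> \<le> measure_pmf.prob (alice (f 0) (VA X)) {m. t \<in> Z m}"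
    if X: "X \<subseteq> {..<n}" and t: "t \<in> X" for X t
  proof -
    have tn: "t < n" using X t by auto
    let ?D = "protocol_output alice bob (f t) (VA X) {0}"
    let ?H = "{S. S \<inter> block q t \<noteq> {}}"
    have fin: "finite (VA X)" using VA_sub[OF X] finite_subset by blast
    have "9 * (real q)\<^sup>2 = f t (insert 0 (block q t))"
      using hard_val_opt[of 0 "{1..<N}" "block q t" q] blk[OF tn] by (simp add: f_def)
    also have "\<dots> \<le> opt_val k (VA X \<union> {0}) (f t)"
    proof -
      have "card (insert 0 (block q t)) \<le> k"
        using k card_insert_le_m1[of k "block q t" 0] by (simp add: q_def)
      moreover have "insert 0 (block q t) \<subseteq> VA X \<union> {0}" using t by (auto simp: VA_def)
      ultimately show ?thesis unfolding opt_val_def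
        using fin by (intro Max_ge) auto
    qed
    finally have "(2/3 + \<epsilon>) * (9 * (real q)\<^sup>2) \<le> (2/3 + \<epsilon>) * opt_val k (VA X \<union> {0}) (f t)"
      using \<epsilon> by (intro mult_left_mono) auto
    also have "\<dots> \<le> measure_pmf.expectation ?D (f t)"
      using approx valid[OF X tn] unfolding approx_guarantee_def by blast
    finally have E: "(2/3 + \<epsilon>) * (9 * (real q)\<^sup>2) \<le> measure_pmf.expectation ?D (f t)" .
    have "3 * \<epsilon> \<le> measure_pmf.prob ?D ?H"
    proof (rule hard_val_hit_prob)
      show "finite S \<and> card S \<le> q + 1" if "S \<in> set_pmf ?D" for S
        using that out[OF X tn] fin k alice_eq[of t "VA X"]
        by (auto simp: protocol_output_def q_def intro: finite_subset)
    qed (use E blk[OF tn] k in \<open>auto simp: f_def[abs_def] q_def\<close>)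
    also have "\<dots> \<le> measure_pmf.prob (alice (f t) (VA X)) {m. set_pmf (bob (f t) {0} m) \<inter> ?H \<noteq> {}}"
      unfolding protocol_output_def by (rule measure_bind_pmf_le_support)
    also have "\<dots> = measure_pmf.prob (alice (f 0) (VA X)) {m. t \<in> Z m}"
      using tn by (simp add: alice_eq[of t] Z_def)
    finally show ?thesis .
  qed
  let ?M = "{m :: bool list. real (length m) < x}"
  show ?thesis
  \<comment> \<open>Some index must exist for \<open>f 0\<close> to be known as a valid
    input.\<close>
  proof (cases "n = 0")
    case True
    then show ?thesis using x by simp
  next
    case False
    have "2 powr (3 * \<epsilon> * n / 2) \<le> 2 * real (card ?M)"
    proof (rule inner_approximation_count[where Z = Z])
      show "finite ?M" using card_bool_lists_less(1)[OF x] .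
      show "\<exists>m\<in>?M. Z m \<subseteq> X \<and> 3 * \<epsilon> * real (card X) \<le> real (card (Z m))" if X: "X \<subseteq> {..<n}" for X
      proof -
        have "finite X" using X finite_subset by blast
        then obtain m where m: "m \<in> set_pmf (alice (f 0) (VA X))"
          "3 * \<epsilon> * real (card X) \<le> real (card (Z m \<inter> X))"
          using exists_outcome_many[of X "3 * \<epsilon>" "alice (f 0) (VA X)" Z] Z_prob[OF X] by blast
        moreover have "m \<in> ?M"
          using short valid[OF X, of 0] False m(1) unfolding comm_complexity_ge_def by force
        ultimately show ?thesis using Z_sub[OF X m(1)] by (auto simp: Int_absorb2)
      qed
    qed (use \<epsilon> in auto)
    also have "\<dots> \<le> 2 * 2 powr (x + 1)" using card_bool_lists_less(2)[OF x] by simp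
    also have "\<dots> = 2 powr (x + 2)" by (simp add: powr_add)
    finally show ?thesis by simp
  qed
qed

section \<open>Choice of the partition and of the constant\<close>

theorem theorem2:
  shows "\<exists>c::real > 0. \<forall>(\<epsilon>::real) (k::nat) (N::nat).
           0 < \<epsilon> \<and> \<epsilon> < 1/4 \<and> real k \<ge> 1 / \<epsilon> \<longrightarrow>
           (\<exists>WA WB :: nat set. finite WA \<and> finite WB \<and> WA \<inter> WB = {} \<and>
              card (WA \<union> WB) = N \<and>
              (\<forall>alice bob. is_protocol k WA WB alice bob \<and>
                  approx_guarantee k WA WB alice bob (2/3 + \<epsilon>) \<longrightarrow>
                  comm_complexity_ge WA WB alice (c * real N * \<epsilon> / real k)))"
proof (intro exI[of _ "1/4"] conjI allI impI, goal_cases)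
  case (2 \<epsilon> k N)
  then have \<epsilon>: "0 < \<epsilon>" "\<epsilon> < 1/4" "1 / \<epsilon> \<le> real k" by auto
  have "4 < 1 / \<epsilon>" using \<epsilon> by (simp add: field_simps)
  \<comment> \<open>This yields the \<open>4 \<le> q\<close> that \<open>hard_val_miss\<close>
    requires.\<close>
  then have k: "5 \<le> k" using \<epsilon>(3) by linarith
  define x where "x = 1/4 * real N * \<epsilon> / real k"
  have x0: "0 \<le> x" using \<epsilon> by (simp add: x_def)
  show ?case
  \<comment> \<open>Below one bit the additive loss in \<open>hard_instance_messages\<close> would
    swamp the bound, and \<open>N\<close> may be too small for a single block.\<close>
  proof (cases "x \<le> 1")
    case True
    have "comm_complexity_ge {..<N} {} alice x"
      if prot: "is_protocol k {..<N} {} alice bob"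
        and approx: "approx_guarantee k {..<N} {} alice bob (2/3 + \<epsilon>)" for alice bob
    \<comment> \<open>Here \<open>x = 0\<close>, so any message is long enough and only a valid
      input must be exhibited.\<close>
    proof (cases "N = 0")
      case True
      have "valid_input {..<N} {} {} {} (\<lambda>_. 0)"
        by (simp add: valid_input_def nonneg_monotone_submodular_def)
      then show ?thesis
        using set_pmf_not_empty[of "alice (\<lambda>_. 0) {}"] True
        unfolding comm_complexity_ge_def x_def by fastforce
    next
      case False
      then have "comm_complexity_ge {..<N} {} alice 1"
        using one_bit_necessary[OF _ prot approx] \<epsilon> k by simp
      then show ?thesis using True unfolding comm_complexity_ge_def by (meson order_trans)
    qed
    then show ?thesis unfolding x_def by (intro exI[of _ "{..<N}"] exI[of _ "{}"]) auto
  next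
    case False
    have "real k \<le> real N"
    proof -
      have "real k < real N * (\<epsilon> / 4)" using False k by (simp add: x_def field_simps)
      also have "\<dots> \<le> real N * 1" using \<epsilon> by (intro mult_left_mono) auto
      finally show ?thesis by simp
    qed
    then have N: "k \<le> N" by simp
    define n where "n = (N - 1) div (k - 1)"
    have "1 \<le> n" using N k unfolding n_def by (simp add: div_greater_zero_iff Suc_leI)
    \<comment> \<open>Rounding down in \<open>n\<close> costs at most a factor 2, since there is at
      least one block.\<close>
    have "N - 1 < (n + 1) * (k - 1)"
      using dividend_less_div_times[of "k - 1" "N - 1"] k by (simp add: n_def algebra_simps)
    also have "\<dots> \<le> 2 * n * (k - 1)" using \<open>1 \<le> n\<close> by (intro mult_right_mono) auto
    also have "\<dots> \<le> 2 * n * k" by simp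
    finally have "N \<le> 2 * n * k" by simp
    then have "real N \<le> 2 * real n * real k" by (metis of_nat_le_iff of_nat_mult of_nat_numeral)
    then have "real N * \<epsilon> \<le> 2 * real n * real k * \<epsilon>" using \<epsilon> by (intro mult_right_mono) auto
    \<comment> \<open>The constant \<open>1/4\<close> is chosen for this: it gives
      \<open>3 * x \<le> 3 * \<epsilon> * n / 2 \<le> x + 2\<close>, contradicting
      \<open>x > 1\<close>.\<close>
    then have x_le: "2 * x \<le> real n * \<epsilon>" using k by (simp add: x_def field_simps)
    have "comm_complexity_ge {1..<N} {0} alice x"
      if "is_protocol k {1..<N} {0} alice bob"
        and "approx_guarantee k {1..<N} {0} alice bob (2/3 + \<epsilon>)" for alice bob
    proof (rule ccontr)
      assume "\<not> ?thesis"
      from hard_instance_messages[OF k \<epsilon>(1) x0 that this]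
      have "3 * \<epsilon> * n / 2 \<le> x + 2" by (simp add: n_def)
      then show False using x_le False by (simp add: mult.commute)
    qed
    moreover have "{1..<N} \<union> {0} = {..<N}" using N k by auto
    ultimately show ?thesis unfolding x_def
      by (intro exI[of _ "{1..<N}"] exI[of _ "{0}"]) auto
  qed
qed simp

end
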